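(* Let $n\ge 1$, $\nu>0$, and let $\alpha_u,\alpha_y\ge 0$ with $\max\{\alpha_u,\alpha_y\}>0$. Let $M\in\mathbb{R}^{n\times n}$ be diagonal with positive diagonal entries, let $L\in\mathbb{R}^{n\times n}$, and let $\Pi_k$ be an $n\times n$ diagonal matrix with diagonal entries in $\{0,1\}$. Set $\gamma_1=\frac{\alpha_y^2\nu}{\alpha_y^2\nu+\alpha_u^2}$, $\gamma_2=\frac{\alpha_u^2}{\alpha_y^2\nu+\alpha_u^2}$, $$\mathbb{S}_k=\nu LM^{-1}L^T+M-\frac{1}{\alpha_y^2\nu+\alpha_u^2}(\alpha_y\nu LM^{-1}-\alpha_u I)\Pi_k M\Pi_k(\alpha_y\nu LM^{-1}-\alpha_u I)^T,$$ $L_1=\sqrt{\nu}L(I-\gamma_1\Pi_k)^{1/2}+(I-\gamma_2\Pi_k)^{1/2}M$ and $\widehat{\mathbb{S}}_k=L_1M^{-1}L_1^T$, and assume $\widehat{\mathbb{S}}_k$ is nonsingular. Let $F=\sqrt{\nu}\,M^{-1/2}LM^{-1/2}$, assumed nonsingular, and define $$G_k=F(I-\Pi_k)+(I-\Pi_k)F^T,\qquad H_k=F(I-\gamma_1\Pi_k)F^T+(I-\gamma_2\Pi_k)+\sqrt{\gamma_1\gamma_2}\,(F\Pi_k+\Pi_kF^T).$$ Then $$\alpha_{\min}:=\min_{z\neq 0}\frac{z^TG_kz}{z^TH_kz}>-1,$$ and every eigenvalue $\lambda$ of the pencil $(\mathbb{S}_k,\widehat{\mathbb{S}}_k)$ (i.e.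 $\mathbb{S}_kx=\lambda\widehat{\mathbb{S}}_kx$ for some $x\neq 0$) satisfies $\lambda\in\left[\tfrac12,\ \tfrac{1}{1+\alpha_{\min}}\right]$.
   Context: Square roots of nonnegative diagonal matrices are taken entrywise; $M^{-1/2}$ is the diagonal matrix with entries $M_{ii}^{-1/2}$. *)

theory Defs
  imports "HOL-Analysis.Analysis"
begin

text \<open>Square n x n real matrices are rendered as real^'n^'n with 'n a finite index type.\<close>

definition is_diag :: "real^'n^'n \<Rightarrow> bool" where
  "is_diag A \<longleftrightarrow> (\<forall>i j. i \<noteq> j \<longrightarrow> A $ i $ j = 0)"

definition diag_mat :: "(('n::finite) \<Rightarrow> real) \<Rightarrow> real^'n^'n" where
  "diag_mat d = (\<chi> i j. if i = j then d i else 0)"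

text \<open>Entrywise square root of a (nonnegative) diagonal matrix.\<close>
definition diag_sqrt :: "real^'n^'n \<Rightarrow> real^'n^'n" where
  "diag_sqrt A = diag_mat (\<lambda>i. sqrt (A $ i $ i))"

text \<open>M^(-1/2) for a diagonal matrix with positive diagonal.\<close>
definition diag_inv_sqrt :: "real^'n^'n \<Rightarrow> real^'n^'n" where
  "diag_inv_sqrt A = diag_mat (\<lambda>i. 1 / sqrt (A $ i $ i))"

definition quad :: "real^'n^'n \<Rightarrow> real^'n \<Rightarrow> real" where
  "quad A z = z \<bullet> (A *v z)"

text \<open>lambda is an eigenvalue of the pencil (A,B): A x = lambda B x for some x \<noteq> 0.\<close>
definition pencil_eigenvalue :: "real^'n^'n \<Rightarrow> real^'n^'n \<Rightarrow> real \<Rightarrow> bool" where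
  "pencil_eigenvalue A B lam \<longleftrightarrow> (\<exists>x. x \<noteq> 0 \<and> A *v x = lam *\<^sub>R (B *v x))"

text \<open>a is the minimum over z \<noteq> 0 of the ratio z^T G z / z^T H z.\<close>
definition is_min_ratio :: "real^'n^'n \<Rightarrow> real^'n^'n \<Rightarrow> real \<Rightarrow> bool" where
  "is_min_ratio G H a \<longleftrightarrow>
     (\<exists>z. z \<noteq> 0 \<and> quad G z / quad H z = a) \<and>
     (\<forall>z. z \<noteq> 0 \<longrightarrow> a \<le> quad G z / quad H z)"

end

theory Submission
  imports Defs
begin

text \<open>
  Put \<open>y = M\<^sup>1\<^sup>/\<^sup>2 x\<close> and \<open>u = F\<^sup>T y\<close>. A coordinatewise computation, using \<open>\<Pi>\<^sub>k\<^sup>2 = \<Pi>\<^sub>k\<close> and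
  \<open>\<gamma>\<^sub>1 + \<gamma>\<^sub>2 = 1\<close>, gives \<open>x\<^sup>T S\<^sub>k x = y\<^sup>T H\<^sub>k y\<close> and \<open>x\<^sup>T Shat\<^sub>k x = y\<^sup>T (H\<^sub>k + G\<^sub>k) y\<close>.
  The summand of \<open>y\<^sup>T H\<^sub>k y\<close> at an active index is the square \<open>(\<surd>\<gamma>\<^sub>2 u + \<surd>\<gamma>\<^sub>1 y)\<^sup>2\<close>, and at
  an inactive one it is \<open>u\<^sup>2 + y\<^sup>2 \<ge> 2 u y\<close>, so \<open>G\<^sub>k \<le> H\<^sub>k\<close> as quadratic forms. Since \<open>Shat\<^sub>k\<close>
  is positive definite, so are \<open>H\<^sub>k + G\<^sub>k\<close> and hence \<open>H\<^sub>k\<close>. Thus the Rayleigh quotient attains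
  its minimum \<open>\<alpha>\<^sub>m\<^sub>i\<^sub>n > -1\<close> on the unit sphere, and an eigenvalue
  \<open>\<lambda> = y\<^sup>T H\<^sub>k y / (y\<^sup>T H\<^sub>k y + y\<^sup>T G\<^sub>k y)\<close> lies in \<open>[1/2, 1/(1 + \<alpha>\<^sub>m\<^sub>i\<^sub>n)]\<close>.
\<close>

lemma diag_mat_nth [simp]: "diag_mat d $ i $ j = (if i = j then d i else 0)"
  by (simp add: diag_mat_def)

lemma diag_mat_mult_nth [simp]: "(diag_mat d ** A) $ i $ j = d i * A $ i $ j"
  by (simp add: matrix_matrix_mult_def if_distrib[of "\<lambda>u. u * _"] cong: if_cong)

lemma mult_diag_mat_nth [simp]: "(A ** diag_mat d) $ i $ j = A $ i $ j * d j"
  by (simp add: matrix_matrix_mult_def if_distrib cong: if_cong)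

lemma diag_mat_mult_vec_nth [simp]: "(diag_mat d *v x) $ i = d i * x $ i"
  by (simp add: matrix_vector_mult_def if_distrib[of "\<lambda>u. u * _"] cong: if_cong)

lemma diag_mat_mult_diag_mat: "diag_mat d ** diag_mat e = diag_mat (\<lambda>i. d i * e i)"
  by (simp add: vec_eq_iff)

lemma transpose_diag_mat [simp]: "transpose (diag_mat d) = diag_mat d"
  by (simp add: vec_eq_iff transpose_def)

lemma diag_mat_diff [simp]: "diag_mat d - diag_mat e = diag_mat (\<lambda>i. d i - e i)"
  by (simp add: vec_eq_iff)

lemma scaleR_diag_mat [simp]: "c *\<^sub>R diag_mat d = diag_mat (\<lambda>i. c * d i)"
  by (simp add: vec_eq_iff)

lemma mat_1_eq_diag_mat: "(mat 1 :: real^'n^'n) = diag_mat (\<lambda>_. 1)"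
  by (simp add: vec_eq_iff mat_def)

lemma is_diag_imp_eq_diag_mat: "is_diag A \<Longrightarrow> A = diag_mat (\<lambda>i. A $ i $ i)"
  by (auto simp: is_diag_def vec_eq_iff)

lemma matrix_inv_eqI:
  fixes A B :: "'a::semiring_1^'n^'n"
  assumes "A ** B = mat 1" and "B ** A = mat 1"
  shows "matrix_inv A = B"
proof -
  let ?inv = "\<lambda>B'. A ** B' = mat 1 \<and> B' ** A = mat 1"
  have "?inv (matrix_inv A)"
    unfolding matrix_inv_def using assms by (rule someI[of ?inv B, OF conjI])
  then have "matrix_inv A = matrix_inv A ** (A ** B)"
    using assms by simp
  also have "\<dots> = B"
    using \<open>?inv (matrix_inv A)\<close> by (simp add: matrix_mul_assoc)
  finally show ?thesis .
qed

lemma matrix_inv_diag_mat: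
  "(\<And>i. d i \<noteq> 0) \<Longrightarrow> matrix_inv (diag_mat d) = diag_mat (\<lambda>i. 1 / d i)"
  by (rule matrix_inv_eqI) (simp_all add: diag_mat_mult_diag_mat mat_1_eq_diag_mat)

lemma quad_add: "quad (A + B) z = quad A z + quad B z"
  by (simp add: quad_def matrix_vector_mult_add_rdistrib inner_add_right)

lemma quad_diff: "quad (A - B) z = quad A z - quad B z"
  by (simp add: quad_def matrix_vector_mult_diff_rdistrib inner_diff_right)

lemma quad_scaleR: "quad (c *\<^sub>R A) z = c * quad A z"
  by (simp add: quad_def matrix_vector_mult_def inner_vec_def sum_distrib_left algebra_simps)

lemma quad_transpose: "quad (transpose A) z = quad A z"
  unfolding quad_def by (metis dot_lmul_matrix inner_commute transpose_matrix_vector)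

lemma quad_scaleR_vector: "quad A (c *\<^sub>R z) = c\<^sup>2 * quad A z"
  by (simp add: quad_def matrix_vector_mult_scaleR power2_eq_square)

lemma quad_diag_mat: "quad (diag_mat d) z = (\<Sum>k\<in>UNIV. d k * (z $ k)\<^sup>2)"
  by (simp add: quad_def inner_vec_def power2_eq_square algebra_simps)

lemma quad_mult_diag_mat:
  "quad (A ** diag_mat d) z = (\<Sum>k\<in>UNIV. d k * (transpose A *v z) $ k * z $ k)"
proof -
  have "quad (A ** diag_mat d) z = (transpose A *v z) \<bullet> (diag_mat d *v z)"
    unfolding quad_def by (metis dot_lmul_matrix matrix_vector_mul_assoc transpose_matrix_vector)
  then show ?thesis by (simp add: inner_vec_def algebra_simps)
qed

lemma quad_congruence_diag_mat:
  "quad (A ** diag_mat d ** transpose A) z = (\<Sum>k\<in>UNIV. d k * ((transpose A *v z) $ k)\<^sup>2)"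
proof -
  have "quad (A ** diag_mat d ** transpose A) z
      = quad (diag_mat d) (transpose A *v z)"
    unfolding quad_def by (metis dot_lmul_matrix matrix_vector_mul_assoc transpose_matrix_vector)
  then show ?thesis by (simp add: quad_diag_mat)
qed

lemma quad_congruence_diag_mat_pos:
  assumes d_pos: "\<And>k. d k > 0"
    and inv: "invertible (A ** diag_mat d ** transpose A)" and "x \<noteq> 0"
  shows "quad (A ** diag_mat d ** transpose A) x > 0"
proof -
  let ?t = "transpose A *v x"
  have terms_nonneg: "\<forall>k\<in>UNIV. 0 \<le> d k * (?t $ k)\<^sup>2"
    using d_pos by (simp add: less_imp_le)
  have "?t \<noteq> 0"
  proof
    assume "?t = 0"
    then have "(A ** diag_mat d ** transpose A) *v x = 0"
      by (metis matrix_vector_mul_assoc matrix_vector_mult_0_right)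
    then show False
      using inj_matrix_vector_mult[OF inv] \<open>x \<noteq> 0\<close> by (metis injD matrix_vector_mult_0_right)
  qed
  then obtain k where "?t $ k \<noteq> 0" by (auto simp: vec_eq_iff)
  then have "0 < d k * (?t $ k)\<^sup>2" using d_pos[of k] by simp
  also have "\<dots> \<le> (\<Sum>k\<in>UNIV. d k * (?t $ k)\<^sup>2)"
    using terms_nonneg by (intro member_le_sum) auto
  finally show ?thesis by (simp add: quad_congruence_diag_mat)
qed

lemma is_min_ratio_exists:
  fixes G H :: "real^'n^'n"
  assumes H_pos: "\<And>z. z \<noteq> 0 \<Longrightarrow> quad H z > 0"
  shows "\<exists>a. is_min_ratio G H a"
proof -
  define f where "f z = quad G z / quad H z" for z :: "real^'n"
  have "continuous_on (sphere 0 1) (\<lambda>z::real^'n. z \<bullet> (G *v z) / (z \<bullet> (H *v z)))"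
    using H_pos unfolding quad_def
    by (intro continuous_intros) (metis less_irrefl norm_zero zero_neq_one mem_sphere_0)
  then have "\<exists>z\<in>sphere 0 1. \<forall>w\<in>sphere 0 1. f z \<le> f w"
    unfolding f_def quad_def by (intro continuous_attains_inf) auto
  then obtain z0 where z0: "norm z0 = 1" "\<And>w. norm w = 1 \<Longrightarrow> f z0 \<le> f w"
    by auto
  have "f z0 \<le> f z" if "z \<noteq> 0" for z
  proof -
    have "f z = f ((1 / norm z) *\<^sub>R z)"
      using that unfolding f_def quad_scaleR_vector by simp
    then show ?thesis using that z0(2) by simp
  qed
  moreover have "z0 \<noteq> 0" using z0(1) by auto
  ultimately show ?thesis
    unfolding is_min_ratio_def f_def by blast
qed

lemma pencil_eigenvector_quad:
  "S *v x = lam *\<^sub>R (Shat *v x) \<Longrightarrow> quad S x = lam * quad Shat x"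
  by (simp add: quad_def)

lemma min_ratio_gt_minus_one:
  assumes "is_min_ratio G H a"
    and G_le_H: "\<And>y. quad G y \<le> quad H y"
    and HG_pos: "\<And>y. y \<noteq> 0 \<Longrightarrow> 0 < quad H y + quad G y"
  shows "a > -1"
proof -
  obtain z where "z \<noteq> 0" and a: "a = quad G z / quad H z"
    using assms(1) unfolding is_min_ratio_def by blast
  have "0 < quad H z + quad G z" using HG_pos[OF \<open>z \<noteq> 0\<close>] .
  moreover have "0 < quad H z" using calculation G_le_H[of z] by linarith
  ultimately show ?thesis unfolding a by (simp add: less_divide_eq)
qed

lemma pencil_ratio_bounds:
  fixes h g a lam :: real
  assumes "g \<le> h" "0 < h + g" "a * h \<le> g" "-1 < a" "h = lam * (h + g)"
  shows "lam \<in> {1/2 .. 1 / (1 + a)}"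
proof -
  have lam: "lam = h / (h + g)" using assms(2,5) by (simp add: field_simps)
  have "1/2 \<le> lam" unfolding lam using assms(1,2) by (simp add: field_simps)
  moreover have "lam \<le> 1 / (1 + a)" unfolding lam using assms(2-4) by (simp add: field_simps)
  ultimately show ?thesis by simp
qed

lemma pencil_eigenvalue_bounds:
  assumes "pencil_eigenvalue S Shat lam" and "is_min_ratio G H a" and "inj ((*v) P)"
    and S_congruent: "\<And>x. quad S x = quad H (P *v x)"
    and Shat_congruent: "\<And>x. quad Shat x = quad H (P *v x) + quad G (P *v x)"
    and G_le_H: "\<And>y. quad G y \<le> quad H y"
    and HG_pos: "\<And>y. y \<noteq> 0 \<Longrightarrow> 0 < quad H y + quad G y"
  shows "lam \<in> {1/2 .. 1 / (1 + a)}"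
proof -
  obtain x where "x \<noteq> 0" and eig: "S *v x = lam *\<^sub>R (Shat *v x)"
    using assms(1) unfolding pencil_eigenvalue_def by blast
  define y where "y = P *v x"
  have "y \<noteq> 0"
    using \<open>x \<noteq> 0\<close> \<open>inj ((*v) P)\<close> unfolding y_def by (metis injD matrix_vector_mult_0_right)
  have "0 < quad H y + quad G y" using HG_pos[OF \<open>y \<noteq> 0\<close>] .
  moreover have H_pos: "0 < quad H y" using calculation G_le_H[of y] by linarith
  moreover have "a * quad H y \<le> quad G y"
    using assms(2) \<open>y \<noteq> 0\<close> H_pos unfolding is_min_ratio_def by (simp add: le_divide_eq)
  moreover have "quad H y = lam * (quad H y + quad G y)"
    using pencil_eigenvector_quad[OF eig] unfolding y_def S_congruent Shat_congruent .
  ultimately show ?thesis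
    using pencil_ratio_bounds G_le_H min_ratio_gt_minus_one[OF assms(2) G_le_H HG_pos] by blast
qed

lemma active_coordinate_bound:
  fixes g1 g2 q u y :: real
  assumes "q = 0 \<or> q = 1" and "g1 \<ge> 0" and "g2 \<ge> 0" and "g1 + g2 = 1"
  shows "2 * (1 - q) * u * y
    \<le> (1 - g1 * q) * u\<^sup>2 + (1 - g2 * q) * y\<^sup>2 + 2 * sqrt (g1 * g2) * q * u * y"
  using assms(1)
proof
  assume "q = 0"
  then show ?thesis by (simp add: sum_squares_bound)
next
  assume "q = 1"
  have "(sqrt g2 * u + sqrt g1 * y)\<^sup>2 = g2 * u\<^sup>2 + g1 * y\<^sup>2 + 2 * sqrt (g1 * g2) * u * y"
    using assms(2,3) by (simp add: power2_sum power_mult_distrib real_sqrt_mult)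
  also have "\<dots> = (1 - g1) * u\<^sup>2 + (1 - g2) * y\<^sup>2 + 2 * sqrt (g1 * g2) * u * y"
    using assms(4) by (simp add: algebra_simps flip: \<open>g1 + g2 = 1\<close>)
  finally have "(1 - g1) * u\<^sup>2 + (1 - g2) * y\<^sup>2 + 2 * sqrt (g1 * g2) * u * y
      = (sqrt g2 * u + sqrt g1 * y)\<^sup>2" ..
  then show ?thesis using \<open>q = 1\<close> by simp
qed

lemma schur_coordinate_identity:
  fixes p s c ay au q t \<xi> :: real
  assumes "p > 0" and "c \<noteq> 0" and "q = 0 \<or> q = 1"
  shows "s\<^sup>2 * (1 / p\<^sup>2 * t\<^sup>2) + p\<^sup>2 * \<xi>\<^sup>2 - 1 / c * (q * p\<^sup>2 * q * (ay * s\<^sup>2 * t / p\<^sup>2 - au * \<xi>)\<^sup>2)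
    = (1 - ay\<^sup>2 * s\<^sup>2 / c * q) * (s * t / p)\<^sup>2 + (1 - au\<^sup>2 / c * q) * (p * \<xi>)\<^sup>2
      + 2 * (ay * au * s / c) * q * (s * t / p) * (p * \<xi>)"
  using assms(3)
proof
  assume "q = 1"
  then show ?thesis using assms(1,2) by (simp add: field_simps power2_eq_square)
qed (use assms in \<open>simp add: field_simps power2_eq_square\<close>)

lemma shat_coordinate_identity:
  fixes p s d1 d2 g1 g2 r q t \<xi> :: real
  assumes "p > 0" and "d1\<^sup>2 = 1 - g1 * q" and "d2\<^sup>2 = 1 - g2 * q" and "d1 * d2 = r * q + (1 - q)"
  shows "1 / p\<^sup>2 * (s * d1 * t + d2 * p\<^sup>2 * \<xi>)\<^sup>2
    = (1 - g1 * q) * (s * t / p)\<^sup>2 + (1 - g2 * q) * (p * \<xi>)\<^sup>2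
      + 2 * r * q * (s * t / p) * (p * \<xi>) + 2 * (1 - q) * (s * t / p) * (p * \<xi>)"
proof -
  have "1 / p\<^sup>2 * (s * d1 * t + d2 * p\<^sup>2 * \<xi>)\<^sup>2 = (d1 * (s * t / p) + d2 * (p * \<xi>))\<^sup>2"
    using assms(1) by (simp add: field_simps power2_eq_square)
  also have "\<dots> = d1\<^sup>2 * (s * t / p)\<^sup>2 + d2\<^sup>2 * (p * \<xi>)\<^sup>2 + 2 * (d1 * d2) * (s * t / p) * (p * \<xi>)"
    unfolding power2_sum power_mult_distrib by (simp only: mult_ac)
  finally show ?thesis
    unfolding assms(2-4) by (simp add: algebra_simps)
qed

locale schur_pencil =
  fixes L :: "real^'n^'n" and m act :: "'n \<Rightarrow> real" and \<nu> au ay :: real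
  assumes nu_pos: "\<nu> > 0" and au_nonneg: "au \<ge> 0" and ay_nonneg: "ay \<ge> 0"
    and weights_pos: "max au ay > 0"
    and m_pos: "\<And>i. m i > 0" and act_01: "\<And>i. act i = 0 \<or> act i = 1"
begin

text \<open>\<open>m\<close> and \<open>act\<close> are the diagonals of \<open>M\<close> and \<open>\<Pi>\<^sub>k\<close>; \<open>act i = 1\<close> marks an active index.\<close>

abbreviation M :: "real^'n^'n" where "M \<equiv> diag_mat m"
abbreviation Pi :: "real^'n^'n" where "Pi \<equiv> diag_mat act"

definition "g1 = ay\<^sup>2 * \<nu> / (ay\<^sup>2 * \<nu> + au\<^sup>2)"
definition "g2 = au\<^sup>2 / (ay\<^sup>2 * \<nu> + au\<^sup>2)"

definition "S = \<nu> *\<^sub>R (L ** matrix_inv M ** transpose L) + M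
      - (1 / (ay\<^sup>2 * \<nu> + au\<^sup>2)) *\<^sub>R
        ((ay * \<nu>) *\<^sub>R (L ** matrix_inv M) - au *\<^sub>R mat 1) ** Pi ** M ** Pi
          ** transpose ((ay * \<nu>) *\<^sub>R (L ** matrix_inv M) - au *\<^sub>R mat 1)"

definition "L1 = sqrt \<nu> *\<^sub>R (L ** diag_sqrt (mat 1 - g1 *\<^sub>R Pi)) + diag_sqrt (mat 1 - g2 *\<^sub>R Pi) ** M"

definition "Shat = L1 ** matrix_inv M ** transpose L1"

definition "F = sqrt \<nu> *\<^sub>R (diag_inv_sqrt M ** L ** diag_inv_sqrt M)"

definition "G = F ** (mat 1 - Pi) + (mat 1 - Pi) ** transpose F"

definition "H = F ** (mat 1 - g1 *\<^sub>R Pi) ** transpose F + (mat 1 - g2 *\<^sub>R Pi)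
             + sqrt (g1 * g2) *\<^sub>R (F ** Pi + Pi ** transpose F)"

lemma matrix_inv_M: "matrix_inv M = diag_mat (\<lambda>i. 1 / m i)"
  using m_pos by (simp add: matrix_inv_diag_mat less_imp_neq[symmetric])

lemma weight_sum_pos: "ay\<^sup>2 * \<nu> + au\<^sup>2 > 0"
proof (cases "au > 0")
  case True
  then show ?thesis using nu_pos by (simp add: add_nonneg_pos)
next
  case False
  then have "ay > 0" using weights_pos au_nonneg by (simp add: max_def split: if_splits)
  then show ?thesis using nu_pos by (simp add: add_pos_nonneg)
qed

lemma g1_nonneg: "g1 \<ge> 0" and g2_nonneg: "g2 \<ge> 0" and g1_plus_g2: "g1 + g2 = 1"
  using weight_sum_pos nu_pos by (simp_all add: g1_def g2_def add_divide_distrib[symmetric])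

lemma sqrt_g1_g2: "sqrt (g1 * g2) = ay * au * sqrt \<nu> / (ay\<^sup>2 * \<nu> + au\<^sup>2)"
proof -
  have "g1 * g2 = (ay * au * sqrt \<nu> / (ay\<^sup>2 * \<nu> + au\<^sup>2))\<^sup>2"
    using nu_pos by (simp add: g1_def g2_def power_divide power_mult_distrib power2_eq_square)
  then show ?thesis
    using au_nonneg ay_nonneg nu_pos weight_sum_pos by simp
qed

lemma diag_sqrt_M_mult_nth: "(diag_sqrt M *v x) $ k = sqrt (m k) * x $ k"
  by (simp add: diag_sqrt_def)

lemma transpose_F_mult_sqrt_M:
  "(transpose F *v (diag_sqrt M *v x)) $ k = sqrt \<nu> * (transpose L *v x) $ k / sqrt (m k)"
proof -
  have "(transpose F *v (diag_sqrt M *v x)) $ k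
      = (\<Sum>i\<in>UNIV. sqrt \<nu> / sqrt (m k) * (x $ i * L $ i $ k))"
    using m_pos by (auto simp: F_def diag_sqrt_def diag_inv_sqrt_def vector_matrix_mult_def
        intro!: sum.cong simp: field_simps less_imp_neq[symmetric])
  then show ?thesis
    by (simp add: vector_matrix_mult_def sum_distrib_left sum_divide_distrib)
qed

lemma quad_H:
  "quad H y = (\<Sum>k\<in>UNIV. (1 - g1 * act k) * ((transpose F *v y) $ k)\<^sup>2
      + (1 - g2 * act k) * (y $ k)\<^sup>2 + 2 * sqrt (g1 * g2) * act k * (transpose F *v y) $ k * y $ k)"
proof -
  have H_eq: "H = F ** diag_mat (\<lambda>k. 1 - g1 * act k) ** transpose F + diag_mat (\<lambda>k. 1 - g2 * act k)
      + sqrt (g1 * g2) *\<^sub>R (F ** Pi + transpose (F ** Pi))"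
    by (simp add: H_def mat_1_eq_diag_mat matrix_transpose_mul)
  have "quad H y = (\<Sum>k\<in>UNIV. (1 - g1 * act k) * ((transpose F *v y) $ k)\<^sup>2)
      + (\<Sum>k\<in>UNIV. (1 - g2 * act k) * (y $ k)\<^sup>2)
      + sqrt (g1 * g2) * (2 * (\<Sum>k\<in>UNIV. act k * (transpose F *v y) $ k * y $ k))"
    unfolding H_eq quad_add quad_scaleR quad_transpose quad_congruence_diag_mat
      quad_mult_diag_mat quad_diag_mat by simp
  also have "\<dots> = (\<Sum>k\<in>UNIV. (1 - g1 * act k) * ((transpose F *v y) $ k)\<^sup>2
      + (1 - g2 * act k) * (y $ k)\<^sup>2 + 2 * sqrt (g1 * g2) * act k * (transpose F *v y) $ k * y $ k)"
    unfolding sum_distrib_left sum.distrib[symmetric] by (rule sum.cong) (simp_all add: algebra_simps)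
  finally show ?thesis .
qed

lemma quad_G: "quad G y = (\<Sum>k\<in>UNIV. 2 * (1 - act k) * (transpose F *v y) $ k * y $ k)"
proof -
  have "G = F ** diag_mat (\<lambda>k. 1 - act k) + transpose (F ** diag_mat (\<lambda>k. 1 - act k))"
    by (simp add: G_def mat_1_eq_diag_mat matrix_transpose_mul)
  then show ?thesis
    by (simp add: quad_add quad_transpose quad_mult_diag_mat sum_distrib_left algebra_simps)
qed

lemma quad_G_le_H: "quad G y \<le> quad H y"
  unfolding quad_G quad_H
  by (intro sum_mono active_coordinate_bound act_01 g1_nonneg g2_nonneg g1_plus_g2)

lemma quad_S: "quad S x = quad H (diag_sqrt M *v x)"
proof -
  define c where "c = ay\<^sup>2 * \<nu> + au\<^sup>2"
  define Y where "Y = (ay * \<nu>) *\<^sub>R (L ** diag_mat (\<lambda>i. 1 / m i)) - au *\<^sub>R mat 1"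
  define l where "l = transpose L *v x"
  have Y_col: "(transpose Y *v x) $ k = ay * \<nu> * l $ k / m k - au * x $ k" for k
    by (simp add: Y_def l_def transpose_scalar matrix_transpose_mul mat_1_eq_diag_mat
        vector_matrix_mult_def sum_subtractf sum_distrib_left sum_divide_distrib algebra_simps
        if_distrib[of "(*) _"] cong: if_cong)
  have S_eq: "S = \<nu> *\<^sub>R (L ** diag_mat (\<lambda>k. 1 / m k) ** transpose L) + M
      - (1 / c) *\<^sub>R (Y ** diag_mat (\<lambda>k. act k * m k * act k) ** transpose Y)"
    by (simp add: S_def c_def Y_def matrix_inv_M scalar_matrix_assoc
        matrix_mul_assoc[symmetric] diag_mat_mult_diag_mat)
  have summand: "\<nu> * (1 / m k * t\<^sup>2) + m k * \<xi>\<^sup>2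
      - 1 / c * (act k * m k * act k * (ay * \<nu> * t / m k - au * \<xi>)\<^sup>2)
    = (1 - g1 * act k) * (sqrt \<nu> * t / sqrt (m k))\<^sup>2 + (1 - g2 * act k) * (sqrt (m k) * \<xi>)\<^sup>2
      + 2 * sqrt (g1 * g2) * act k * (sqrt \<nu> * t / sqrt (m k)) * (sqrt (m k) * \<xi>)" for k t \<xi>
    unfolding sqrt_g1_g2
    using schur_coordinate_identity
        [where p = "sqrt (m k)" and s = "sqrt \<nu>" and c = c and q = "act k"]
      m_pos[of k] nu_pos weight_sum_pos act_01[of k]
    by (simp add: g1_def g2_def c_def)
  have "quad S x = (\<Sum>k\<in>UNIV. \<nu> * (1 / m k * (l $ k)\<^sup>2) + m k * (x $ k)\<^sup>2
      - 1 / c * (act k * m k * act k * ((transpose Y *v x) $ k)\<^sup>2))"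
    unfolding S_eq quad_diff quad_add quad_scaleR quad_congruence_diag_mat quad_diag_mat l_def
    by (simp only: sum.distrib sum_subtractf sum_distrib_left)
  also have "\<dots> = quad H (diag_sqrt M *v x)"
    unfolding quad_H transpose_F_mult_sqrt_M diag_sqrt_M_mult_nth Y_col summand l_def ..
  finally show ?thesis .
qed

lemma quad_Shat: "quad Shat x = quad H (diag_sqrt M *v x) + quad G (diag_sqrt M *v x)"
proof -
  define d1 where "d1 k = sqrt (1 - g1 * act k)" for k
  define d2 where "d2 k = sqrt (1 - g2 * act k)" for k
  define l where "l = transpose L *v x"
  have d1_sq: "(d1 k)\<^sup>2 = 1 - g1 * act k" and d2_sq: "(d2 k)\<^sup>2 = 1 - g2 * act k" for k
    using act_01[of k] g1_nonneg g2_nonneg g1_plus_g2 by (auto simp: d1_def d2_def)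
  have d1_d2: "d1 k * d2 k = sqrt (g1 * g2) * act k + (1 - act k)" for k
    using act_01[of k] g1_plus_g2
    by (auto simp: d1_def d2_def real_sqrt_mult[symmetric] mult.commute
        add.commute[of g1] eq_diff_eq[symmetric])
  have L1_col: "(transpose L1 *v x) $ k = sqrt \<nu> * d1 k * l $ k + d2 k * m k * x $ k" for k
    by (simp add: L1_def l_def d1_def d2_def diag_sqrt_def mat_1_eq_diag_mat transpose_scalar
        matrix_transpose_mul vector_matrix_mult_def sum.distrib sum_distrib_left algebra_simps
        if_distrib[of "(*) _"] cong: if_cong)
  have summand: "1 / m k * (sqrt \<nu> * d1 k * t + d2 k * m k * \<xi>)\<^sup>2
    = (1 - g1 * act k) * (sqrt \<nu> * t / sqrt (m k))\<^sup>2 + (1 - g2 * act k) * (sqrt (m k) * \<xi>)\<^sup>2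
      + 2 * sqrt (g1 * g2) * act k * (sqrt \<nu> * t / sqrt (m k)) * (sqrt (m k) * \<xi>)
      + 2 * (1 - act k) * (sqrt \<nu> * t / sqrt (m k)) * (sqrt (m k) * \<xi>)" for k t \<xi>
    using shat_coordinate_identity[where p = "sqrt (m k)", OF _ d1_sq d2_sq d1_d2] m_pos[of k]
    by simp
  have "quad Shat x = (\<Sum>k\<in>UNIV. 1 / m k * ((transpose L1 *v x) $ k)\<^sup>2)"
    unfolding Shat_def matrix_inv_M quad_congruence_diag_mat ..
  also have "\<dots> = quad H (diag_sqrt M *v x) + quad G (diag_sqrt M *v x)"
    unfolding quad_H quad_G sum.distrib[symmetric] transpose_F_mult_sqrt_M diag_sqrt_M_mult_nth
      L1_col summand l_def
    by (rule sum.cong) (simp_all add: algebra_simps)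
  finally show ?thesis .
qed

lemma inj_diag_sqrt_M: "inj ((*v) (diag_sqrt M))"
  using m_pos by (auto simp: inj_def vec_eq_iff diag_sqrt_M_mult_nth less_imp_neq[symmetric])

lemma quad_H_plus_G_pos:
  assumes "invertible Shat" and "y \<noteq> 0"
  shows "0 < quad H y + quad G y"
proof -
  define x where "x = diag_mat (\<lambda>k. 1 / sqrt (m k)) *v y"
  have y: "diag_sqrt M *v x = y"
    using m_pos by (simp add: x_def vec_eq_iff diag_sqrt_M_mult_nth less_imp_neq[symmetric])
  then have "x \<noteq> 0" using \<open>y \<noteq> 0\<close> by auto
  have "0 < quad (L1 ** diag_mat (\<lambda>k. 1 / m k) ** transpose L1) x"
    using m_pos assms(1) \<open>x \<noteq> 0\<close>
    by (intro quad_congruence_diag_mat_pos) (simp_all add: Shat_def matrix_inv_M)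
  then show ?thesis
    using quad_Shat[of x] unfolding y by (simp add: Shat_def matrix_inv_M)
qed

theorem pencil_spectrum:
  assumes "invertible Shat"
  shows "\<exists>amin. is_min_ratio G H amin \<and> amin > -1 \<and>
           (\<forall>lam. pencil_eigenvalue S Shat lam \<longrightarrow> lam \<in> {1/2 .. 1 / (1 + amin)})"
proof -
  note HG_pos = quad_H_plus_G_pos[OF assms]
  have "quad H y > 0" if "y \<noteq> 0" for y
    using HG_pos[OF that] quad_G_le_H[of y] by linarith
  then obtain amin where amin: "is_min_ratio G H amin"
    using is_min_ratio_exists by blast
  show ?thesis
  proof (intro exI conjI allI impI)
    show "is_min_ratio G H amin" by (fact amin)
    show "amin > -1" using min_ratio_gt_minus_one[OF amin quad_G_le_H HG_pos] .
    show "lam \<in> {1/2 .. 1 / (1 + amin)}" if "pencil_eigenvalue S Shat lam" for lam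
      using pencil_eigenvalue_bounds
        [OF that amin inj_diag_sqrt_M quad_S quad_Shat quad_G_le_H HG_pos] .
  qed
qed

end

theorem proposition4p3:
  fixes M L Pi :: "real^'n^'n" and \<nu> au ay :: real
  assumes nu_pos: "\<nu> > 0"
    and au: "au \<ge> 0" and ay: "ay \<ge> 0" and amax: "max au ay > 0"
    and M_diag: "is_diag M" and M_pos: "\<forall>i. M $ i $ i > 0"
    and Pi_diag: "is_diag Pi" and Pi_01: "\<forall>i. Pi $ i $ i = 0 \<or> Pi $ i $ i = 1"
  defines "g1 \<equiv> ay^2 * \<nu> / (ay^2 * \<nu> + au^2)"
    and "g2 \<equiv> au^2 / (ay^2 * \<nu> + au^2)"
    and "Minv \<equiv> matrix_inv M"
    and "I \<equiv> (mat 1 :: real^'n^'n)"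
  defines "S \<equiv> \<nu> *\<^sub>R (L ** Minv ** transpose L) + M
      - (1 / (ay^2 * \<nu> + au^2)) *\<^sub>R
        ((ay * \<nu>) *\<^sub>R (L ** Minv) - au *\<^sub>R I) ** Pi ** M ** Pi
          ** transpose ((ay * \<nu>) *\<^sub>R (L ** Minv) - au *\<^sub>R I)"
    and "L1 \<equiv> sqrt \<nu> *\<^sub>R (L ** diag_sqrt (I - g1 *\<^sub>R Pi)) + diag_sqrt (I - g2 *\<^sub>R Pi) ** M"
  defines "Shat \<equiv> L1 ** Minv ** transpose L1"
    and "F \<equiv> sqrt \<nu> *\<^sub>R (diag_inv_sqrt M ** L ** diag_inv_sqrt M)"
  defines "G \<equiv> F ** (I - Pi) + (I - Pi) ** transpose F"
    and "H \<equiv> F ** (I - g1 *\<^sub>R Pi) ** transpose F + (I - g2 *\<^sub>R Pi)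
             + sqrt (g1 * g2) *\<^sub>R (F ** Pi + Pi ** transpose F)"
  assumes Shat_inv: "invertible Shat"
    and F_inv: "invertible F"
  shows "\<exists>amin. is_min_ratio G H amin \<and> amin > -1 \<and>
           (\<forall>lam. pencil_eigenvalue S Shat lam \<longrightarrow> lam \<in> {1/2 .. 1 / (1 + amin)})"
proof -
  obtain m act where M: "M = diag_mat m" and Pi: "Pi = diag_mat act"
    using is_diag_imp_eq_diag_mat[OF M_diag] is_diag_imp_eq_diag_mat[OF Pi_diag] by blast
  interpret sp: schur_pencil L m act \<nu> au ay
    using nu_pos au ay amax M_pos Pi_01 by unfold_locales (auto simp: M Pi)
  have "S = sp.S" and "Shat = sp.Shat" and "G = sp.G" and "H = sp.H"
    unfolding S_def sp.S_def Shat_def sp.Shat_def L1_def sp.L1_def G_def sp.G_def H_def sp.H_def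
      F_def sp.F_def g1_def sp.g1_def g2_def sp.g2_def Minv_def I_def M Pi by (rule refl)+
  then show ?thesis
    using sp.pencil_spectrum Shat_inv by simp
qed

end
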